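(* Let $G$ be a strongly topological gyrogroup and let $H$ be a closed strong subgyrogroup of $G$. If $H$ is neutral, then $G/H$ is biradial if and only if $G/H$ is nested.
   Context: A gyrogroup is a nonempty set $G$ with a binary operation $\oplus$ such that: (G1) there is $0\in G$ with $0\oplus x=x=x\oplus 0$ for all $x\in G$; (G2) each $x\in G$ has an inverse $\ominus x\in G$ with $\ominus x\oplus x=0=x\oplus(\ominus x)$; (G3) for all $x,y\in G$ there is an automorphism $\mathrm{gyr}[x,y]$ of $(G,\oplus)$ (a bijection preserving $\oplus$) with $x\oplus(y\oplus z)=(x\oplus y)\oplus \mathrm{gyr}[x,y](z)$ for all $z\in G$; (G4) $\mathrm{gyr}[x\oplus y,y]=\mathrm{gyr}[x,y]$ for all $x,y\in G$. For $A,B\subseteq G$, $A\oplus B=\{a\oplus b:a\in A,b\in B\}$ and $\ominus A=\{\ominus a:a\in A\}$. A subset $A\subseteq G$ is gyr-invariant if $\mathrm{gyr}[x,y](A)=A$ for all $x,y\in G$. A subgyrogroup is a nonempty $H\subseteq G$ closed under $\oplus$ and $\ominus$; it is strong if it is gyr-invariant. A topological gyrogroup is a gyrogroup with a topology for which $\oplus:G\times G\to G$ and $\ominus:G\to G$ are continuous; it is strongly topological if every neighborhood of $0$ contains a gyr-invariant neighborhood of $0$. A subgyrogroup $H$ is neutral if for every neighborhood $U$ of $0$ there are open neighborhoods $V,V'$ of $0$ with $H\oplus V\subseteq U\oplus H$ and $V'\oplus H\subseteq H\oplus U$. For a strong subgyrogroup $H$, $G/H=\{a\oplus H:a\in G\}$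 is a partition of $G$ and carries the quotient topology of the map $a\mapsto a\oplus H$. No separation axiom is assumed unless stated. Let $X$ be a space. A prefilter on $X$ is a family $\zeta$ of nonempty subsets of $X$ such that for $P_1,P_2\in\zeta$ there is $P\in\zeta$ with $P\subseteq P_1\cap P_2$. A prefilter converges to $x\in X$ if every open neighborhood of $x$ contains an element of it. Two prefilters $\zeta,\eta$ are synchronous if $P\cap Q\ne\emptyset$ for all $P\in\zeta$, $Q\in\eta$. $X$ is biradial if for every prefilter $\zeta$ on $X$ converging to a point $x\in X$ there is a chain $\eta$ (with respect to inclusion) of nonempty subsets of $X$ converging to $x$ and synchronous with $\zeta$. A nest is a prefilter of open subsets of $X$ such that for any two members $U,V$ either $U\subseteq V$ or $V\subseteq U$. $X$ is nested at $x$ if some nest in $X$ forms a local base at $x$; $X$ is nested if it is nested at each of its points. *)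

theory Defs
  imports "HOL-Analysis.Analysis"
begin

section \<open>Gyrogroups\<close>

text \<open>
  The operations are fields of a record and the axioms are relativised to the carrier.
  The neutral element, the inverses and (by left cancellation) the gyrations are determined on
  the carrier by the binary operation, so bundling them as data is no loss of generality.
\<close>

record 'a gyro =
  gcarrier :: "'a set"
  gadd :: "'a \<Rightarrow> 'a \<Rightarrow> 'a"  (infixl "\<oplus>\<index>" 65)
  gzero :: 'a  ("\<zero>\<index>")
  gminus :: "'a \<Rightarrow> 'a"  ("\<ominus>\<index> _" [81] 80)
  gyr :: "'a \<Rightarrow> 'a \<Rightarrow> 'a \<Rightarrow> 'a"

definition gyro_automorphism :: "('a, 'b) gyro_scheme \<Rightarrow> ('a \<Rightarrow> 'a) \<Rightarrow> bool" where
  "gyro_automorphism G f \<longleftrightarrow>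
     bij_betw f (gcarrier G) (gcarrier G) \<and>
     (\<forall>x\<in>gcarrier G. \<forall>y\<in>gcarrier G. f (x \<oplus>\<^bsub>G\<^esub> y) = f x \<oplus>\<^bsub>G\<^esub> f y)"

locale gyrogroup =
  fixes G :: "('a, 'b) gyro_scheme" (structure)
  assumes add_closed: "\<lbrakk>x \<in> gcarrier G; y \<in> gcarrier G\<rbrakk> \<Longrightarrow> x \<oplus> y \<in> gcarrier G"
    and zero_closed: "\<zero> \<in> gcarrier G"
    and zero_add: "x \<in> gcarrier G \<Longrightarrow> \<zero> \<oplus> x = x"
    and add_zero: "x \<in> gcarrier G \<Longrightarrow> x \<oplus> \<zero> = x"
    and minus_closed: "x \<in> gcarrier G \<Longrightarrow> \<ominus> x \<in> gcarrier G"
    and minus_add: "x \<in> gcarrier G \<Longrightarrow> (\<ominus> x) \<oplus> x = \<zero>"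
    and add_minus: "x \<in> gcarrier G \<Longrightarrow> x \<oplus> (\<ominus> x) = \<zero>"
    and gyr_automorphism:
      "\<lbrakk>x \<in> gcarrier G; y \<in> gcarrier G\<rbrakk> \<Longrightarrow> gyro_automorphism G (gyr G x y)"
    and gyr_assoc:
      "\<lbrakk>x \<in> gcarrier G; y \<in> gcarrier G; z \<in> gcarrier G\<rbrakk>
        \<Longrightarrow> x \<oplus> (y \<oplus> z) = (x \<oplus> y) \<oplus> gyr G x y z"
    and gyr_loop:
      "\<lbrakk>x \<in> gcarrier G; y \<in> gcarrier G; z \<in> gcarrier G\<rbrakk>
        \<Longrightarrow> gyr G (x \<oplus> y) y z = gyr G x y z"

definition set_gadd :: "('a, 'b) gyro_scheme \<Rightarrow> 'a set \<Rightarrow> 'a set \<Rightarrow> 'a set" where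
  "set_gadd G A B = {a \<oplus>\<^bsub>G\<^esub> b | a b. a \<in> A \<and> b \<in> B}"

definition gyr_invariant :: "('a, 'b) gyro_scheme \<Rightarrow> 'a set \<Rightarrow> bool" where
  "gyr_invariant G A \<longleftrightarrow> (\<forall>x\<in>gcarrier G. \<forall>y\<in>gcarrier G. gyr G x y ` A = A)"

definition subgyrogroup :: "('a, 'b) gyro_scheme \<Rightarrow> 'a set \<Rightarrow> bool" where
  "subgyrogroup G H \<longleftrightarrow>
     H \<noteq> {} \<and> H \<subseteq> gcarrier G \<and>
     (\<forall>x\<in>H. \<forall>y\<in>H. x \<oplus>\<^bsub>G\<^esub> y \<in> H) \<and> (\<forall>x\<in>H. \<ominus>\<^bsub>G\<^esub> x \<in> H)"

definition strong_subgyrogroup :: "('a, 'b) gyro_scheme \<Rightarrow> 'a set \<Rightarrow> bool" where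
  "strong_subgyrogroup G H \<longleftrightarrow> subgyrogroup G H \<and> gyr_invariant G H"


section \<open>Topological gyrogroups\<close>

text \<open>A neighbourhood of a point need not be open.\<close>

definition nbhd_of :: "'a topology \<Rightarrow> 'a \<Rightarrow> 'a set \<Rightarrow> bool" where
  "nbhd_of X x N \<longleftrightarrow> N \<subseteq> topspace X \<and> (\<exists>U. openin X U \<and> x \<in> U \<and> U \<subseteq> N)"

locale topological_gyrogroup = gyrogroup G
  for G :: "('a, 'b) gyro_scheme" (structure) +
  fixes T :: "'a topology"
  assumes topspace_eq: "topspace T = gcarrier G"
    and continuous_add: "continuous_map (prod_topology T T) T (\<lambda>(x, y). x \<oplus> y)"
    and continuous_minus: "continuous_map T T (\<lambda>x. \<ominus> x)"

locale strongly_topological_gyrogroup = topological_gyrogroup +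
  assumes gyr_invariant_nbhd:
    "nbhd_of T \<zero> U \<Longrightarrow> \<exists>V. nbhd_of T \<zero> V \<and> V \<subseteq> U \<and> gyr_invariant G V"

definition neutral_subgyrogroup ::
    "('a, 'b) gyro_scheme \<Rightarrow> 'a topology \<Rightarrow> 'a set \<Rightarrow> bool" where
  "neutral_subgyrogroup G T H \<longleftrightarrow>
     subgyrogroup G H \<and>
     (\<forall>U. nbhd_of T \<zero>\<^bsub>G\<^esub> U \<longrightarrow>
       (\<exists>V V'. openin T V \<and> \<zero>\<^bsub>G\<^esub> \<in> V \<and> openin T V' \<and> \<zero>\<^bsub>G\<^esub> \<in> V' \<and>
          set_gadd G H V \<subseteq> set_gadd G U H \<and>
          set_gadd G V' H \<subseteq> set_gadd G H U))"


section \<open>The coset space\<close>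

definition quotient_topology :: "'a topology \<Rightarrow> ('a \<Rightarrow> 'b) \<Rightarrow> 'b topology" where
  "quotient_topology X f =
     topology (\<lambda>W. W \<subseteq> f ` topspace X \<and> openin X {x \<in> topspace X. f x \<in> W})"

lemma openin_quotient_topology:
  "openin (quotient_topology X f) W \<longleftrightarrow>
     W \<subseteq> f ` topspace X \<and> openin X {x \<in> topspace X. f x \<in> W}"
proof -
  have "istopology (\<lambda>W. W \<subseteq> f ` topspace X \<and> openin X {x \<in> topspace X. f x \<in> W})"
    unfolding istopology_def
  proof (intro conjI allI impI)
    fix S T
    assume S: "S \<subseteq> f ` topspace X \<and> openin X {x \<in> topspace X. f x \<in> S}"
      and T: "T \<subseteq> f ` topspace X \<and> openin X {x \<in> topspace X. f x \<in> T}"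
    show "S \<inter> T \<subseteq> f ` topspace X" using S by blast
    have "{x \<in> topspace X. f x \<in> S \<inter> T}
        = {x \<in> topspace X. f x \<in> S} \<inter> {x \<in> topspace X. f x \<in> T}" by blast
    then show "openin X {x \<in> topspace X. f x \<in> S \<inter> T}" using S T by auto
  next
    fix \<K>
    assume K: "\<forall>K\<in>\<K>. K \<subseteq> f ` topspace X \<and> openin X {x \<in> topspace X. f x \<in> K}"
    show "\<Union>\<K> \<subseteq> f ` topspace X" using K by blast
    have "{x \<in> topspace X. f x \<in> \<Union>\<K>} = (\<Union>K\<in>\<K>. {x \<in> topspace X. f x \<in> K})" by blast
    then show "openin X {x \<in> topspace X. f x \<in> \<Union>\<K>}" using K by auto
  qed
  then show ?thesis by (simp add: quotient_topology_def)
qed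

lemma topspace_quotient_topology: "topspace (quotient_topology X f) = f ` topspace X"
proof
  show "topspace (quotient_topology X f) \<subseteq> f ` topspace X"
    by (rule openin_quotient_topology[THEN iffD1, THEN conjunct1, OF openin_topspace])
  have "{x \<in> topspace X. f x \<in> f ` topspace X} = topspace X" by blast
  then show "f ` topspace X \<subseteq> topspace (quotient_topology X f)"
    by (intro openin_subset) (simp add: openin_quotient_topology)
qed

lemma quotient_map_quotient_topology: "quotient_map X (quotient_topology X f) f"
  by (simp add: quotient_map_def topspace_quotient_topology openin_quotient_topology)

definition gyro_coset :: "('a, 'b) gyro_scheme \<Rightarrow> 'a set \<Rightarrow> 'a \<Rightarrow> 'a set" where
  "gyro_coset G H a = set_gadd G {a} H"

definition coset_space :: "('a, 'b) gyro_scheme \<Rightarrow> 'a topology \<Rightarrow> 'a set \<Rightarrow> 'a set topology" where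
  "coset_space G T H = quotient_topology T (gyro_coset G H)"


section \<open>Biradial and nested spaces\<close>

definition prefilter_on :: "'a topology \<Rightarrow> 'a set set \<Rightarrow> bool" where
  "prefilter_on X \<zeta> \<longleftrightarrow>
     (\<forall>P\<in>\<zeta>. P \<noteq> {} \<and> P \<subseteq> topspace X) \<and>
     (\<forall>P1\<in>\<zeta>. \<forall>P2\<in>\<zeta>. \<exists>P\<in>\<zeta>. P \<subseteq> P1 \<inter> P2)"

definition family_converges :: "'a topology \<Rightarrow> 'a set set \<Rightarrow> 'a \<Rightarrow> bool" where
  "family_converges X \<zeta> x \<longleftrightarrow> (\<forall>U. openin X U \<and> x \<in> U \<longrightarrow> (\<exists>P\<in>\<zeta>. P \<subseteq> U))"

definition synchronous :: "'a set set \<Rightarrow> 'a set set \<Rightarrow> bool" where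
  "synchronous \<zeta> \<eta> \<longleftrightarrow> (\<forall>P\<in>\<zeta>. \<forall>Q\<in>\<eta>. P \<inter> Q \<noteq> {})"

definition biradial_space :: "'a topology \<Rightarrow> bool" where
  "biradial_space X \<longleftrightarrow>
     (\<forall>\<zeta>. \<forall>x\<in>topspace X. prefilter_on X \<zeta> \<and> family_converges X \<zeta> x \<longrightarrow>
        (\<exists>\<eta>. (\<forall>Q\<in>\<eta>. Q \<noteq> {} \<and> Q \<subseteq> topspace X) \<and> chain_subset \<eta> \<and>
             family_converges X \<eta> x \<and> synchronous \<zeta> \<eta>))"

definition nest_on :: "'a topology \<Rightarrow> 'a set set \<Rightarrow> bool" where
  "nest_on X \<N> \<longleftrightarrow> prefilter_on X \<N> \<and> (\<forall>U\<in>\<N>. openin X U) \<and> chain_subset \<N>"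

definition local_base_at :: "'a topology \<Rightarrow> 'a \<Rightarrow> 'a set set \<Rightarrow> bool" where
  "local_base_at X x \<B> \<longleftrightarrow>
     (\<forall>B\<in>\<B>. openin X B \<and> x \<in> B) \<and>
     (\<forall>U. openin X U \<and> x \<in> U \<longrightarrow> (\<exists>B\<in>\<B>. B \<subseteq> U))"

definition nested_at :: "'a topology \<Rightarrow> 'a \<Rightarrow> bool" where
  "nested_at X x \<longleftrightarrow> (\<exists>\<N>. nest_on X \<N> \<and> local_base_at X x \<N>)"

definition nested_space :: "'a topology \<Rightarrow> bool" where
  "nested_space X \<longleftrightarrow> (\<forall>x\<in>topspace X. nested_at X x)"

end

theory Submission
  imports Defs
begin

text \<open>
  A nest that is a local base at \<open>x\<close> is itself a chain converging to \<open>x\<close>, and its members meet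
  every member of a prefilter converging to \<open>x\<close>; so nested spaces are biradial, and only the
  converse needs the algebra.

  For the converse, biradiality is applied to the prefilter of all sets \<open>U - N\<close>, where \<open>U\<close> is an
  open neighbourhood of the base coset and \<open>N\<close> is nowhere dense. A set that meets all of these
  cannot be nowhere dense, so the result is a chain of sets \<open>Q\<close> that converges to the base coset
  and for which \<open>O = int (cl Q)\<close> is never empty (lemma \<open>biradial_chain_somewhere_dense\<close>). With
  \<open>W\<close> the preimage of \<open>O\<close> in the gyrogroup, the set \<open>\<ominus> W \<oplus> W\<close> is an open neighbourhood of
  \<open>\<zero>\<close>. It grows with \<open>Q\<close>, so these sets form a chain again, and the images of their left
  translates by \<open>a\<close> are a nest of open neighbourhoods of \<open>a \<oplus> H\<close>.

  It remains to see that this nest is a local base, which amounts to three estimates for a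
  neighbourhood \<open>U\<close> of \<open>\<zero>\<close>. If \<open>V\<close> is small enough, then (i) inverses of elements of
  \<open>V \<oplus> H\<close> lie in \<open>U \<oplus> H\<close>, (ii) so do sums of two such elements, and (iii) the closure of the
  image of \<open>V\<close> in the coset space is contained in the image of \<open>U\<close>. Neutrality moves an
  element of \<open>H\<close> past a small element, and gyr-invariant neighbourhoods absorb the gyrations
  produced by re-bracketing; (iii) gives the regularity needed to control \<open>int (cl Q)\<close>.
\<close>

section \<open>Nested and biradial spaces\<close>

lemma nested_imp_biradial:
  assumes "nested_space X"
  shows "biradial_space X"
  unfolding biradial_space_def
proof (intro allI ballI impI)
  fix \<zeta> x
  assume x: "x \<in> topspace X" and z: "prefilter_on X \<zeta> \<and> family_converges X \<zeta> x"
  obtain \<N> where N: "nest_on X \<N>" "local_base_at X x \<N>"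
    using assms x unfolding nested_space_def nested_at_def by blast
  have "synchronous \<zeta> \<N>"
    unfolding synchronous_def
  proof (intro ballI)
    fix P B assume P: "P \<in> \<zeta>" and B: "B \<in> \<N>"
    have "openin X B" "x \<in> B" using B N(2) by (auto simp: local_base_at_def)
    then obtain P' where P': "P' \<in> \<zeta>" "P' \<subseteq> B"
      using z unfolding family_converges_def by blast
    obtain P'' where "P'' \<in> \<zeta>" "P'' \<subseteq> P \<inter> P'"
      using z P P'(1) unfolding prefilter_on_def by meson
    moreover from this have "P'' \<noteq> {}" using z unfolding prefilter_on_def by simp
    ultimately show "P \<inter> B \<noteq> {}" using P'(2) by auto
  qed
  moreover have "family_converges X \<N> x"
    using N(2) unfolding family_converges_def local_base_at_def by blast
  ultimately show "\<exists>\<eta>. (\<forall>Q\<in>\<eta>. Q \<noteq> {} \<and> Q \<subseteq> topspace X) \<and> chain_subset \<eta> \<and>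
             family_converges X \<eta> x \<and> synchronous \<zeta> \<eta>"
    using N(1) unfolding nest_on_def prefilter_on_def by blast
qed

lemma nowhere_dense_Un:
  assumes "X interior_of (X closure_of M) = {}" "X interior_of (X closure_of N) = {}"
  shows "X interior_of (X closure_of (M \<union> N)) = {}"
  using interior_of_union_eq_empty[of X "X closure_of M" "X closure_of N"] assms
  by (simp add: closure_of_Un)

text \<open>
  Removing nowhere dense sets from the neighbourhoods of \<open>x\<close> leaves a prefilter, because
  nonempty open sets are not nowhere dense. A nowhere dense set \<open>Q\<close> is never synchronous with it, as it misses
  \<open>topspace X - Q\<close>.
\<close>

lemma biradial_chain_somewhere_dense:
  assumes "biradial_space X" "x \<in> topspace X"
  obtains \<eta> where "chain_subset \<eta>" "family_converges X \<eta> x"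
    "\<And>Q. Q \<in> \<eta> \<Longrightarrow> Q \<subseteq> topspace X \<and> X interior_of (X closure_of Q) \<noteq> {}"
proof -
  define \<zeta> where
    "\<zeta> = {U - N | U N. openin X U \<and> x \<in> U \<and> X interior_of (X closure_of N) = {}}"
  have "prefilter_on X \<zeta>"
    unfolding prefilter_on_def
  proof (intro conjI ballI)
    fix P assume "P \<in> \<zeta>"
    then obtain U N where UN: "P = U - N" "openin X U" "x \<in> U"
      "X interior_of (X closure_of N) = {}" unfolding \<zeta>_def by blast
    then show "P \<subseteq> topspace X" using openin_subset by blast
    show "P \<noteq> {}"
    proof
      assume "P = {}"
      then have "U \<subseteq> topspace X \<inter> N" using UN openin_subset by blast
      then have "U \<subseteq> X closure_of N"
        using closure_of_subset_Int[of X N] by blast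
      then have "U \<subseteq> X interior_of (X closure_of N)"
        using UN(2) by (simp add: interior_of_maximal)
      then show False using UN by blast
    qed
  next
    fix P1 P2 assume "P1 \<in> \<zeta>" "P2 \<in> \<zeta>"
    then obtain U1 N1 U2 N2 where *:
      "P1 = U1 - N1" "openin X U1" "x \<in> U1" "X interior_of (X closure_of N1) = {}"
      "P2 = U2 - N2" "openin X U2" "x \<in> U2" "X interior_of (X closure_of N2) = {}"
      unfolding \<zeta>_def by blast
    then have "(U1 \<inter> U2) - (N1 \<union> N2) \<in> \<zeta>"
      unfolding \<zeta>_def using nowhere_dense_Un[of X N1 N2] by blast
    then show "\<exists>P\<in>\<zeta>. P \<subseteq> P1 \<inter> P2"
      by (rule rev_bexI) (use *(1,5) in auto)
  qed
  moreover have "family_converges X \<zeta> x"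
    unfolding family_converges_def
  proof (intro allI impI)
    fix U assume "openin X U \<and> x \<in> U"
    then have "U - {} \<in> \<zeta>"
      unfolding \<zeta>_def by (intro CollectI exI[of _ U] exI[of _ "{}"]) simp
    then show "\<exists>P\<in>\<zeta>. P \<subseteq> U" by (rule rev_bexI) simp
  qed
  ultimately obtain \<eta> where \<eta>: "\<forall>Q\<in>\<eta>. Q \<noteq> {} \<and> Q \<subseteq> topspace X" "chain_subset \<eta>"
    "family_converges X \<eta> x" "synchronous \<zeta> \<eta>"
    using assms unfolding biradial_space_def by blast
  have "X interior_of (X closure_of Q) \<noteq> {}" if Q: "Q \<in> \<eta>" for Q
  proof
    assume "X interior_of (X closure_of Q) = {}"
    then have "topspace X - Q \<in> \<zeta>" unfolding \<zeta>_def using assms(2) by blast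
    then show False using \<eta>(4) Q unfolding synchronous_def by blast
  qed
  with \<eta> that show thesis by blast
qed


section \<open>Cancellation in gyrogroups\<close>

context gyrogroup
begin

lemma gyr_closed:
  "\<lbrakk>x \<in> gcarrier G; y \<in> gcarrier G; z \<in> gcarrier G\<rbrakk> \<Longrightarrow> gyr G x y z \<in> gcarrier G"
  using gyr_automorphism[of x y] unfolding gyro_automorphism_def bij_betw_def by blast

lemma gyr_inj:
  "\<lbrakk>x \<in> gcarrier G; y \<in> gcarrier G; z \<in> gcarrier G; z' \<in> gcarrier G;
    gyr G x y z = gyr G x y z'\<rbrakk> \<Longrightarrow> z = z'"
  using gyr_automorphism[of x y] unfolding gyro_automorphism_def bij_betw_def inj_on_def by blast

lemma gyr_add:
  "\<lbrakk>x \<in> gcarrier G; y \<in> gcarrier G; z \<in> gcarrier G; z' \<in> gcarrier G\<rbrakk>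
    \<Longrightarrow> gyr G x y (z \<oplus> z') = gyr G x y z \<oplus> gyr G x y z'"
  using gyr_automorphism[of x y] unfolding gyro_automorphism_def by blast

lemma add_left_imp_eq:
  assumes "a \<in> gcarrier G" "x \<in> gcarrier G" "y \<in> gcarrier G" "a \<oplus> x = a \<oplus> y"
  shows "x = y"
proof -
  have m: "\<ominus> a \<in> gcarrier G" using assms by (simp add: minus_closed)
  have *: "\<ominus> a \<oplus> (a \<oplus> z) = gyr G (\<ominus> a) a z" if "z \<in> gcarrier G" for z
    using gyr_assoc[OF m assms(1) that] assms m that
    by (simp add: minus_add zero_add gyr_closed)
  have "gyr G (\<ominus> a) a x = gyr G (\<ominus> a) a y" using *[of x] *[of y] assms by simp
  then show ?thesis using gyr_inj m assms by blast
qed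

text \<open>
  The gyration \<open>gyr[\<ominus> a, a]\<close> is trivial: by the loop property it equals \<open>gyr[\<zero>, a]\<close>, and
  associativity at \<open>\<zero>\<close> forces that one to be the identity.
\<close>

lemma minus_add_cancel:
  assumes "a \<in> gcarrier G" "b \<in> gcarrier G"
  shows "\<ominus> a \<oplus> (a \<oplus> b) = b"
proof -
  have m: "\<ominus> a \<in> gcarrier G" using assms by (simp add: minus_closed)
  have "a \<oplus> b = a \<oplus> gyr G \<zero> a b"
    using gyr_assoc[OF zero_closed assms] assms by (simp add: zero_add add_closed)
  then have "gyr G \<zero> a b = b"
    using add_left_imp_eq[OF assms(1,2)] gyr_closed zero_closed assms by metis
  then have "gyr G (\<ominus> a) a b = b"
    using gyr_loop[OF m assms] minus_add[OF assms(1)] by simp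
  then show ?thesis
    using gyr_assoc[OF m assms] assms by (simp add: minus_add zero_add)
qed

lemma minus_minus: "a \<in> gcarrier G \<Longrightarrow> \<ominus> (\<ominus> a) = a"
  using minus_add_cancel[of "\<ominus> a" a] by (simp add: minus_closed minus_add add_zero)

lemma add_minus_cancel:
  "\<lbrakk>a \<in> gcarrier G; b \<in> gcarrier G\<rbrakk> \<Longrightarrow> a \<oplus> (\<ominus> a \<oplus> b) = b"
  using minus_add_cancel[of "\<ominus> a" b] by (simp add: minus_closed minus_minus)

lemma gyr_minus:
  assumes "x \<in> gcarrier G" "y \<in> gcarrier G" "z \<in> gcarrier G"
  shows "gyr G x y (\<ominus> z) = \<ominus> gyr G x y z"
proof -
  let ?f = "gyr G x y"
  have c: "?f u \<in> gcarrier G" if "u \<in> gcarrier G" for u using gyr_closed assms that by blast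
  have "?f \<zero> \<oplus> ?f \<zero> = ?f \<zero> \<oplus> \<zero>"
    using gyr_add[OF assms(1,2) zero_closed zero_closed]
    by (simp add: zero_add add_zero zero_closed c)
  then have f0: "?f \<zero> = \<zero>" using add_left_imp_eq c zero_closed by blast
  have "?f z \<oplus> ?f (\<ominus> z) = ?f z \<oplus> \<ominus> ?f z"
    using gyr_add[OF assms minus_closed[OF assms(3)]] f0
    by (simp add: add_minus c assms)
  then show ?thesis
    by (rule add_left_imp_eq[rotated 3]) (use c minus_closed assms in auto)
qed

lemma add_gyr_minus_cancel:
  assumes "x \<in> gcarrier G" "y \<in> gcarrier G"
  shows "(x \<oplus> y) \<oplus> \<ominus> gyr G x y y = x"
  using gyr_assoc[OF assms minus_closed[OF assms(2)]] assms
  by (simp add: add_minus add_zero gyr_minus)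

end


section \<open>Cosets of a strong subgyrogroup\<close>

locale gyrogroup_strong_subgyrogroup = gyrogroup +
  fixes H
  assumes strong_subgyrogroup: "strong_subgyrogroup G H"
begin

abbreviation coset where "coset \<equiv> gyro_coset G H"

lemma H_subset: "h \<in> H \<Longrightarrow> h \<in> gcarrier G"
  and H_add: "\<lbrakk>h \<in> H; k \<in> H\<rbrakk> \<Longrightarrow> h \<oplus> k \<in> H"
  and H_minus: "h \<in> H \<Longrightarrow> \<ominus> h \<in> H"
  using strong_subgyrogroup unfolding strong_subgyrogroup_def subgyrogroup_def by auto

lemma zero_in_H: "\<zero> \<in> H"
proof -
  obtain h where "h \<in> H"
    using strong_subgyrogroup unfolding strong_subgyrogroup_def subgyrogroup_def by auto
  then show ?thesis using H_add[of "\<ominus> h" h] H_minus H_subset minus_add by fastforce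
qed

lemma gyr_image_H:
  "\<lbrakk>x \<in> gcarrier G; y \<in> gcarrier G\<rbrakk> \<Longrightarrow> gyr G x y ` H = H"
  using strong_subgyrogroup unfolding strong_subgyrogroup_def gyr_invariant_def by blast

lemma mem_coset_iff: "x \<in> coset a \<longleftrightarrow> (\<exists>h\<in>H. x = a \<oplus> h)"
  unfolding gyro_coset_def set_gadd_def by blast

lemma self_in_coset: "a \<in> gcarrier G \<Longrightarrow> a \<in> coset a"
  unfolding mem_coset_iff using zero_in_H add_zero by metis

text \<open>
  Strength enters here: re-bracketing \<open>(a \<oplus> h) \<oplus> k\<close> changes \<open>k\<close> by a gyration, which permutes \<open>H\<close>.
\<close>

lemma coset_add_H:
  assumes "a \<in> gcarrier G" "h \<in> H"
  shows "coset (a \<oplus> h) = coset a"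
proof (intro set_eqI iffI)
  fix x assume "x \<in> coset (a \<oplus> h)"
  then obtain k where k: "k \<in> H" "x = (a \<oplus> h) \<oplus> k" unfolding mem_coset_iff by blast
  obtain l where l: "l \<in> H" "k = gyr G a h l"
    using gyr_image_H[of a h] assms H_subset k(1) by blast
  then have "x = a \<oplus> (h \<oplus> l)"
    using k gyr_assoc[of a h l] assms H_subset by simp
  then show "x \<in> coset a" unfolding mem_coset_iff using H_add assms l by blast
next
  fix x assume "x \<in> coset a"
  then obtain k where k: "k \<in> H" "x = a \<oplus> k" unfolding mem_coset_iff by blast
  let ?l = "\<ominus> h \<oplus> k"
  have l: "?l \<in> H" using assms k H_add H_minus by blast
  have "x = a \<oplus> (h \<oplus> ?l)" using k assms H_subset add_minus_cancel by simp
  also have "\<dots> = (a \<oplus> h) \<oplus> gyr G a h ?l" using gyr_assoc assms l H_subset by blast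
  finally show "x \<in> coset (a \<oplus> h)"
    unfolding mem_coset_iff using gyr_image_H[of a h] assms l H_subset by blast
qed

lemma coset_eq_iff:
  assumes "x \<in> gcarrier G" "y \<in> gcarrier G"
  shows "coset x = coset y \<longleftrightarrow> (\<exists>h\<in>H. x = y \<oplus> h)"
  using assms self_in_coset[of x] coset_add_H mem_coset_iff by metis

lemma coset_add_left_cong:
  assumes "a \<in> gcarrier G" "x \<in> gcarrier G" "y \<in> gcarrier G" "coset x = coset y"
  shows "coset (a \<oplus> x) = coset (a \<oplus> y)"
proof -
  obtain h where h: "h \<in> H" "x = y \<oplus> h" using assms coset_eq_iff by blast
  then have "a \<oplus> x = (a \<oplus> y) \<oplus> gyr G a y h" using gyr_assoc assms H_subset by simp
  moreover have "gyr G a y h \<in> H" using gyr_image_H assms h by blast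
  ultimately show ?thesis using coset_add_H add_closed assms by simp
qed

lemma coset_in_image:
  assumes "x \<in> set_gadd G U H" "U \<subseteq> gcarrier G"
  shows "coset x \<in> coset ` U"
  using assms coset_add_H unfolding set_gadd_def by blast

end


section \<open>The quotient map onto the coset space\<close>

context topological_gyrogroup
begin

lemma continuous_add_left: "a \<in> gcarrier G \<Longrightarrow> continuous_map T T (\<lambda>x. a \<oplus> x)"
  and continuous_add_right: "a \<in> gcarrier G \<Longrightarrow> continuous_map T T (\<lambda>x. x \<oplus> a)"
proof -
  assume a: "a \<in> gcarrier G"
  have "continuous_map T (prod_topology T T) (\<lambda>x. (a, x))"
    "continuous_map T (prod_topology T T) (\<lambda>x. (x, a))"
    using a by (simp_all add: continuous_map_paired topspace_eq)
  from this[THEN continuous_map_compose[OF _ continuous_add]]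
  show "continuous_map T T (\<lambda>x. a \<oplus> x)" "continuous_map T T (\<lambda>x. x \<oplus> a)"
    by (simp_all add: o_def)
qed

lemma openin_add_left:
  assumes a: "a \<in> gcarrier G" and U: "openin T U"
  shows "openin T ((\<lambda>x. a \<oplus> x) ` U)"
proof -
  have sub: "U \<subseteq> gcarrier G" using U openin_subset topspace_eq by blast
  have "(\<lambda>x. a \<oplus> x) ` U = {x \<in> topspace T. \<ominus> a \<oplus> x \<in> U}"
  proof (intro set_eqI iffI)
    fix y assume "y \<in> {x \<in> topspace T. \<ominus> a \<oplus> x \<in> U}"
    then show "y \<in> (\<lambda>x. a \<oplus> x) ` U"
      using a by (intro image_eqI[of _ _ "\<ominus> a \<oplus> y"]) (auto simp: topspace_eq add_minus_cancel)
  qed (use a sub in \<open>auto simp: topspace_eq add_closed minus_add_cancel\<close>)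
  then show ?thesis
    using openin_continuous_map_preimage[OF continuous_add_left[OF minus_closed[OF a]] U] by simp
qed

lemma nbhd_of_zeroI: "\<lbrakk>openin T U; \<zero> \<in> U\<rbrakk> \<Longrightarrow> nbhd_of T \<zero> U"
  unfolding nbhd_of_def using openin_subset by blast

lemma nbhd_zero_add:
  assumes "nbhd_of T \<zero> U"
  obtains V where "nbhd_of T \<zero> V" "\<And>x y. \<lbrakk>x \<in> V; y \<in> V\<rbrakk> \<Longrightarrow> x \<oplus> y \<in> U"
proof -
  obtain U' where U': "openin T U'" "\<zero> \<in> U'" "U' \<subseteq> U" using assms unfolding nbhd_of_def by blast
  have "openin (prod_topology T T) {p \<in> topspace (prod_topology T T). (\<lambda>(x, y). x \<oplus> y) p \<in> U'}"
    using openin_continuous_map_preimage[OF continuous_add U'(1)] .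
  moreover have "(\<zero>, \<zero>) \<in> {p \<in> topspace (prod_topology T T). (\<lambda>(x, y). x \<oplus> y) p \<in> U'}"
    using U' by (simp add: topspace_eq zero_closed zero_add)
  ultimately obtain A B where AB: "openin T A" "openin T B" "\<zero> \<in> A" "\<zero> \<in> B"
    "A \<times> B \<subseteq> {p \<in> topspace (prod_topology T T). (\<lambda>(x, y). x \<oplus> y) p \<in> U'}"
    unfolding openin_prod_topology_alt by meson
  have "nbhd_of T \<zero> (A \<inter> B)" using AB by (intro nbhd_of_zeroI) auto
  moreover have "x \<oplus> y \<in> U" if "x \<in> A \<inter> B" "y \<in> A \<inter> B" for x y
  proof -
    have "(x, y) \<in> A \<times> B" using that by simp
    then have "(\<lambda>(x, y). x \<oplus> y) (x, y) \<in> U'" using AB(5) by blast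
    then show ?thesis using U'(3) by auto
  qed
  ultimately show thesis using that by blast
qed

end

locale topological_gyrogroup_strong_subgyrogroup =
  topological_gyrogroup + gyrogroup_strong_subgyrogroup
begin

lemma openin_coset_space:
  "openin (coset_space G T H) W \<longleftrightarrow>
     W \<subseteq> coset ` gcarrier G \<and> openin T {x \<in> gcarrier G. coset x \<in> W}"
  unfolding coset_space_def openin_quotient_topology topspace_eq by simp

lemma topspace_coset_space: "topspace (coset_space G T H) = coset ` gcarrier G"
  unfolding coset_space_def topspace_quotient_topology topspace_eq by simp

text \<open>
  Each point \<open>x\<close> of \<open>v \<oplus> H\<close> is moved back to \<open>v\<close> by adding a suitable \<open>k \<in> H\<close> on the right.
  Points near \<open>x\<close> are then moved into \<open>V\<close> by the same \<open>k\<close>, without leaving their cosets.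
\<close>

lemma openin_coset_image:
  assumes V: "openin T V"
  shows "openin (coset_space G T H) (coset ` V)"
proof -
  have sub: "V \<subseteq> gcarrier G" using V openin_subset topspace_eq by blast
  have "\<exists>N. openin T N \<and> x \<in> N \<and> N \<subseteq> {x \<in> gcarrier G. coset x \<in> coset ` V}"
    if x: "x \<in> {x \<in> gcarrier G. coset x \<in> coset ` V}" for x
  proof -
    obtain v where v: "v \<in> V" "coset v = coset x" using x by auto
    then obtain k where k: "k \<in> H" "v = x \<oplus> k" using coset_eq_iff sub x by blast
    let ?N = "{y \<in> topspace T. y \<oplus> k \<in> V}"
    have "openin T ?N"
      using openin_continuous_map_preimage[OF continuous_add_right V] k H_subset by blast
    moreover have "x \<in> ?N" using x v k topspace_eq by simp
    moreover have "?N \<subseteq> {x \<in> gcarrier G. coset x \<in> coset ` V}"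
    proof
      fix y assume y: "y \<in> ?N"
      then have "coset y = coset (y \<oplus> k)" using coset_add_H k topspace_eq by simp
      then show "y \<in> {x \<in> gcarrier G. coset x \<in> coset ` V}" using y topspace_eq by simp
    qed
    ultimately show ?thesis by blast
  qed
  then have "openin T {x \<in> gcarrier G. coset x \<in> coset ` V}"
    using openin_subopen[of T "{x \<in> gcarrier G. coset x \<in> coset ` V}"] by meson
  then show ?thesis using sub unfolding openin_coset_space by blast
qed

end


section \<open>Small neighbourhoods modulo a neutral subgyrogroup\<close>

locale neutral_strong_subgyrogroup =
  strongly_topological_gyrogroup + topological_gyrogroup_strong_subgyrogroup +
  assumes neutral: "neutral_subgyrogroup G T H"
begin

text \<open>
  The inclusion \<open>H \<oplus> A \<subseteq> U \<oplus> H\<close> supplied by neutrality is made available for \<open>v\<close> and \<open>\<ominus> v\<close>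
  simultaneously, by shrinking to a set where both lie in \<open>A\<close> before choosing a gyr-invariant one.
\<close>

lemma gyr_invariant_nbhd_neutral:
  assumes "nbhd_of T \<zero> U"
  obtains V where "nbhd_of T \<zero> V" "V \<subseteq> U" "V \<subseteq> gcarrier G" "gyr_invariant G V"
    "\<And>v. v \<in> V \<Longrightarrow> \<ominus> v \<in> U"
    "\<And>h v. \<lbrakk>h \<in> H; v \<in> V\<rbrakk> \<Longrightarrow> coset (h \<oplus> v) \<in> coset ` U"
    "\<And>h v. \<lbrakk>h \<in> H; v \<in> V\<rbrakk> \<Longrightarrow> coset (h \<oplus> \<ominus> v) \<in> coset ` U"
proof -
  obtain U' where U': "openin T U'" "\<zero> \<in> U'" "U' \<subseteq> U" using assms unfolding nbhd_of_def by blast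
  obtain A where A: "openin T A" "\<zero> \<in> A" "set_gadd G H A \<subseteq> set_gadd G U H"
    using neutral assms unfolding neutral_subgyrogroup_def by blast
  let ?B = "(A \<inter> U') \<inter> {x \<in> topspace T. \<ominus> x \<in> A \<inter> U'}"
  have AU: "openin T (A \<inter> U')" using A U' by blast
  have "\<ominus> \<zero> = \<zero>" using add_minus[OF zero_closed] zero_add[OF minus_closed[OF zero_closed]] by simp
  then have "\<zero> \<in> ?B" using A U' topspace_eq zero_closed by simp
  moreover have "openin T ?B"
    using AU openin_continuous_map_preimage[OF continuous_minus AU] by blast
  ultimately obtain V where V: "nbhd_of T \<zero> V" "V \<subseteq> ?B" "gyr_invariant G V"
    using gyr_invariant_nbhd nbhd_of_zeroI by meson
  have U: "U \<subseteq> gcarrier G" using assms unfolding nbhd_of_def topspace_eq by blast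
  have *: "coset (h \<oplus> a) \<in> coset ` U" if "h \<in> H" "a \<in> A" for h a
  proof -
    have "h \<oplus> a \<in> set_gadd G H A" using that unfolding set_gadd_def by blast
    then show ?thesis using A(3) coset_in_image U by blast
  qed
  show thesis
    by (rule that[OF V(1) _ _ V(3)]) (use V(2) U'(3) U * in blast)+
qed

text \<open>
  If \<open>w \<oplus> k = p\<close> with \<open>k \<in> H\<close>, then \<open>\<ominus> w \<oplus> p = k\<close>, and cancelling \<open>p\<close> on the right writes
  \<open>\<ominus> w\<close> as \<open>k\<close> plus the inverse of a gyration of \<open>p\<close>.
\<close>

lemma nbhd_coset_minus:
  assumes "nbhd_of T \<zero> U"
  obtains V where "nbhd_of T \<zero> V"
    "\<And>w. \<lbrakk>w \<in> gcarrier G; coset w \<in> coset ` V\<rbrakk> \<Longrightarrow> coset (\<ominus> w) \<in> coset ` U"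
proof -
  obtain V where V: "nbhd_of T \<zero> V" "V \<subseteq> gcarrier G" "gyr_invariant G V"
    "\<And>h v. \<lbrakk>h \<in> H; v \<in> V\<rbrakk> \<Longrightarrow> coset (h \<oplus> \<ominus> v) \<in> coset ` U"
    using gyr_invariant_nbhd_neutral[OF assms] by metis
  have "coset (\<ominus> w) \<in> coset ` U" if w: "w \<in> gcarrier G" "coset w \<in> coset ` V" for w
  proof -
    obtain p where p: "p \<in> V" "coset p = coset w" using w by auto
    have pc: "p \<in> gcarrier G" using p V by blast
    obtain k where k: "k \<in> H" "p = w \<oplus> k" using coset_eq_iff pc w p by blast
    let ?p = "gyr G (\<ominus> w) p p"
    have "\<ominus> w \<oplus> p = k" using k w H_subset minus_add_cancel by simp
    then have "\<ominus> w = k \<oplus> \<ominus> ?p"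
      using add_gyr_minus_cancel[of "\<ominus> w" p] w pc minus_closed by simp
    moreover have "?p \<in> V"
      using V(3) p w pc minus_closed unfolding gyr_invariant_def by blast
    ultimately show ?thesis using V(4)[OF k(1)] by metis
  qed
  then show thesis using that V(1) by blast
qed

text \<open>
  Modulo \<open>H\<close> the second summand can be taken in \<open>V\<close>. Then \<open>(p \<oplus> h) \<oplus> p'\<close> is re-bracketed as
  \<open>p \<oplus> (h \<oplus> q)\<close> with \<open>q \<in> V\<close>, and neutrality replaces \<open>h \<oplus> q\<close> by a small element.
\<close>

lemma nbhd_coset_add:
  assumes "nbhd_of T \<zero> U"
  obtains V where "nbhd_of T \<zero> V"
    "\<And>a b. \<lbrakk>a \<in> gcarrier G; b \<in> gcarrier G; coset a \<in> coset ` V; coset b \<in> coset ` V\<rbrakk>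
      \<Longrightarrow> coset (a \<oplus> b) \<in> coset ` U"
proof -
  obtain U2 where U2: "nbhd_of T \<zero> U2" "\<And>x y. \<lbrakk>x \<in> U2; y \<in> U2\<rbrakk> \<Longrightarrow> x \<oplus> y \<in> U"
    using nbhd_zero_add[OF assms] by metis
  have U2c: "U2 \<subseteq> gcarrier G" using U2(1) unfolding nbhd_of_def topspace_eq by blast
  obtain V where V: "nbhd_of T \<zero> V" "V \<subseteq> U2" "gyr_invariant G V"
    "\<And>h v. \<lbrakk>h \<in> H; v \<in> V\<rbrakk> \<Longrightarrow> coset (h \<oplus> v) \<in> coset ` U2"
    using gyr_invariant_nbhd_neutral[OF U2(1)] by metis
  have "coset (a \<oplus> b) \<in> coset ` U"
    if ab: "a \<in> gcarrier G" "b \<in> gcarrier G" "coset a \<in> coset ` V" "coset b \<in> coset ` V" for a b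
  proof -
    obtain p p' where p: "p \<in> V" "coset a = coset p" "p' \<in> V" "coset b = coset p'"
      using ab by auto
    have pc: "p \<in> gcarrier G" "p' \<in> gcarrier G" using p V U2c by auto
    obtain h where h: "h \<in> H" "a = p \<oplus> h" using coset_eq_iff ab p pc by blast
    have hc: "h \<in> gcarrier G" using h H_subset by blast
    have "gyr G p h ` V = V" using V(3) pc hc unfolding gyr_invariant_def by blast
    then obtain q where q: "q \<in> V" "p' = gyr G p h q" using p by blast
    have qc: "q \<in> gcarrier G" using q V U2c by auto
    obtain u where u: "u \<in> U2" "coset (h \<oplus> q) = coset u" using V(4) h q by blast
    have uc: "u \<in> gcarrier G" using u U2c by auto
    have "coset (a \<oplus> b) = coset (a \<oplus> p')" using coset_add_left_cong ab pc p by blast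
    also have "a \<oplus> p' = p \<oplus> (h \<oplus> q)" using gyr_assoc[OF pc(1) hc qc] q h by simp
    also have "coset \<dots> = coset (p \<oplus> u)"
      using coset_add_left_cong pc hc qc uc u add_closed by blast
    finally show ?thesis using U2(2) p V(2) u by blast
  qed
  then show thesis using that V(1) by blast
qed

text \<open>
  If the coset of \<open>z\<close> is adherent to the image of \<open>V\<close>, then \<open>z \<oplus> v\<close> lies in \<open>V \<oplus> H\<close> for some
  \<open>v \<in> V\<close>; cancelling \<open>v\<close> exhibits \<open>z\<close> as a sum of two elements that are small modulo \<open>H\<close>.
\<close>

lemma nbhd_coset_closure:
  assumes "nbhd_of T \<zero> U"
  obtains V where "nbhd_of T \<zero> V" "coset_space G T H closure_of (coset ` V) \<subseteq> coset ` U"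
proof -
  obtain U1 where U1: "nbhd_of T \<zero> U1"
    "\<And>a b. \<lbrakk>a \<in> gcarrier G; b \<in> gcarrier G; coset a \<in> coset ` U1; coset b \<in> coset ` U1\<rbrakk>
      \<Longrightarrow> coset (a \<oplus> b) \<in> coset ` U"
    using nbhd_coset_add[OF assms] by metis
  obtain V where V: "nbhd_of T \<zero> V" "V \<subseteq> U1" "V \<subseteq> gcarrier G" "gyr_invariant G V"
    "\<And>v. v \<in> V \<Longrightarrow> \<ominus> v \<in> U1"
    using gyr_invariant_nbhd_neutral[OF U1(1)] by metis
  obtain V0 where V0: "openin T V0" "\<zero> \<in> V0" "V0 \<subseteq> V" using V(1) unfolding nbhd_of_def by blast
  have "c \<in> coset ` U" if c: "c \<in> coset_space G T H closure_of (coset ` V)" for c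
  proof -
    obtain z where z: "z \<in> gcarrier G" "c = coset z"
      using c in_closure_of topspace_coset_space by (metis imageE)
    let ?W = "coset ` (\<lambda>x. z \<oplus> x) ` V0"
    have "openin (coset_space G T H) ?W" using openin_coset_image openin_add_left z V0 by blast
    moreover have "c \<in> ?W" using z V0(2) add_zero[OF z(1)] by (metis imageI)
    ultimately obtain y where y: "y \<in> coset ` V" "y \<in> ?W"
      using c unfolding in_closure_of by meson
    then obtain v where v: "v \<in> V" "coset (z \<oplus> v) \<in> coset ` V" using V0(3) by auto
    have vc: "v \<in> gcarrier G" using v V by blast
    let ?v = "gyr G z v v"
    have "?v \<in> V" using V(4) v z vc unfolding gyr_invariant_def by blast
    then have "\<ominus> ?v \<in> U1" "\<ominus> ?v \<in> gcarrier G" using V minus_closed by auto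
    moreover have "z \<oplus> v \<in> gcarrier G" using z vc add_closed by blast
    moreover have "coset (z \<oplus> v) \<in> coset ` U1" using v V(2) by blast
    ultimately have "coset ((z \<oplus> v) \<oplus> \<ominus> ?v) \<in> coset ` U" using U1(2) by blast
    then show ?thesis using add_gyr_minus_cancel[OF z(1) vc] z by simp
  qed
  then show thesis using that V(1) by blast
qed

text \<open>
  Passing to the closure here is what makes the estimate usable for \<open>int (cl Q)\<close> when only
  \<open>Q\<close> itself is known to be small.
\<close>

lemma nbhd_coset_difference:
  assumes "nbhd_of T \<zero> U"
  obtains V where "nbhd_of T \<zero> V"
    "\<And>w u. \<lbrakk>w \<in> gcarrier G; u \<in> gcarrier G;
        coset w \<in> coset_space G T H closure_of (coset ` V);
        coset u \<in> coset_space G T H closure_of (coset ` V)\<rbrakk>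
      \<Longrightarrow> coset (\<ominus> w \<oplus> u) \<in> coset ` U"
proof -
  obtain A where A: "nbhd_of T \<zero> A"
    "\<And>a b. \<lbrakk>a \<in> gcarrier G; b \<in> gcarrier G; coset a \<in> coset ` A; coset b \<in> coset ` A\<rbrakk>
      \<Longrightarrow> coset (a \<oplus> b) \<in> coset ` U"
    using nbhd_coset_add[OF assms] by metis
  obtain B where B: "nbhd_of T \<zero> B"
    "\<And>w. \<lbrakk>w \<in> gcarrier G; coset w \<in> coset ` B\<rbrakk> \<Longrightarrow> coset (\<ominus> w) \<in> coset ` A"
    using nbhd_coset_minus[OF A(1)] by metis
  have "nbhd_of T \<zero> (A \<inter> B)"
    using A(1) B(1) unfolding nbhd_of_def by (meson IntI Int_mono inf.coboundedI1 openin_Int)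
  then obtain V where V: "nbhd_of T \<zero> V"
    "coset_space G T H closure_of (coset ` V) \<subseteq> coset ` (A \<inter> B)"
    using nbhd_coset_closure by metis
  show thesis
  proof (rule that[OF V(1)])
    fix w u
    assume "w \<in> gcarrier G" "u \<in> gcarrier G"
      "coset w \<in> coset_space G T H closure_of (coset ` V)"
      "coset u \<in> coset_space G T H closure_of (coset ` V)"
    note wu = this
    have "coset w \<in> coset ` (A \<inter> B)" "coset u \<in> coset ` (A \<inter> B)"
      using V(2) wu by (simp_all add: subset_iff)
    then have "coset w \<in> coset ` B" "coset u \<in> coset ` A" by auto
    then show "coset (\<ominus> w \<oplus> u) \<in> coset ` U"
      using A(2)[OF minus_closed[OF wu(1)] wu(2)] B(2)[OF wu(1)] by simp
  qed
qed


section \<open>The nest of translated difference sets\<close>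

text \<open>
  This is the image of \<open>a \<oplus> (\<ominus> W' \<oplus> W')\<close>, where \<open>W'\<close> is the preimage of \<open>W\<close>. Taking full
  preimages makes the operation monotone in \<open>W\<close>, so that it turns chains into chains.
\<close>

definition difference_nbhd :: "'a \<Rightarrow> 'a set set \<Rightarrow> 'a set set" where
  "difference_nbhd a W =
     coset ` {a \<oplus> (\<ominus> w \<oplus> u) | w u.
       w \<in> gcarrier G \<and> u \<in> gcarrier G \<and> coset w \<in> W \<and> coset u \<in> W}"

lemma difference_nbhd_mono: "W \<subseteq> W' \<Longrightarrow> difference_nbhd a W \<subseteq> difference_nbhd a W'"
  unfolding difference_nbhd_def by blast

lemma openin_difference_nbhd:
  assumes a: "a \<in> gcarrier G" and W: "openin (coset_space G T H) W"
  shows "openin (coset_space G T H) (difference_nbhd a W)"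
proof -
  let ?W = "{x \<in> gcarrier G. coset x \<in> W}"
  have "openin T ((\<lambda>x. a \<oplus> x) ` (\<lambda>x. \<ominus> w \<oplus> x) ` ?W)" if "w \<in> ?W" for w
    using that a W openin_coset_space minus_closed by (intro openin_add_left) auto
  then have "openin T (\<Union>w\<in>?W. (\<lambda>x. a \<oplus> x) ` (\<lambda>x. \<ominus> w \<oplus> x) ` ?W)" by blast
  moreover have "difference_nbhd a W = coset ` (\<Union>w\<in>?W. (\<lambda>x. a \<oplus> x) ` (\<lambda>x. \<ominus> w \<oplus> x) ` ?W)"
    unfolding difference_nbhd_def by (rule arg_cong[where f = "image coset"]) blast
  ultimately show ?thesis using openin_coset_image by simp
qed

lemma coset_in_difference_nbhd:
  assumes a: "a \<in> gcarrier G" and W: "openin (coset_space G T H) W" "W \<noteq> {}"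
  shows "coset a \<in> difference_nbhd a W"
proof -
  obtain w where w: "w \<in> gcarrier G" "coset w \<in> W"
    using W unfolding openin_coset_space by blast
  then have "a \<oplus> (\<ominus> w \<oplus> w) = a" using a minus_add add_zero by simp
  then show ?thesis
    unfolding difference_nbhd_def using w by (metis (mono_tags, lifting) imageI mem_Collect_eq)
qed

text \<open>
  One chain at the base coset serves every point \<open>a \<oplus> H\<close>: for a neighbourhood of \<open>a \<oplus> H\<close>, its
  preimage under \<open>y \<mapsto> (a \<oplus> y) \<oplus> H\<close> is the neighbourhood \<open>U\<close> of \<open>\<zero>\<close> to which the estimates apply.
\<close>

theorem biradial_coset_space_imp_nested:
  assumes "biradial_space (coset_space G T H)"
  shows "nested_space (coset_space G T H)"
  unfolding nested_space_def
proof
  let ?X = "coset_space G T H"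
  fix x assume "x \<in> topspace ?X"
  then obtain a where a: "a \<in> gcarrier G" "x = coset a" using topspace_coset_space by auto
  have "coset \<zero> \<in> topspace ?X" using topspace_coset_space zero_closed by blast
  then obtain \<eta> where \<eta>: "chain_subset \<eta>" "family_converges ?X \<eta> (coset \<zero>)"
    "\<And>Q. Q \<in> \<eta> \<Longrightarrow> Q \<subseteq> topspace ?X \<and> ?X interior_of (?X closure_of Q) \<noteq> {}"
    using biradial_chain_somewhere_dense[OF assms] by metis
  define N where "N Q = difference_nbhd a (?X interior_of (?X closure_of Q))" for Q
  have N_open: "openin ?X (N Q)" for Q
    unfolding N_def using openin_difference_nbhd a by simp
  have N_mem: "x \<in> N Q" if "Q \<in> \<eta>" for Q
    unfolding N_def using coset_in_difference_nbhd a \<eta>(3)[OF that] by simp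
  have N_mono: "N Q \<subseteq> N Q'" if "Q \<subseteq> Q'" for Q Q'
    unfolding N_def using that by (intro difference_nbhd_mono interior_of_mono closure_of_mono)
  have chain: "chain_subset (N ` \<eta>)"
    unfolding chain_subset_def
  proof (intro ballI)
    fix P P' assume "P \<in> N ` \<eta>" "P' \<in> N ` \<eta>"
    then obtain Q Q' where "P = N Q" "P' = N Q'" "Q \<in> \<eta>" "Q' \<in> \<eta>" by auto
    then show "P \<subseteq> P' \<or> P' \<subseteq> P"
      using \<eta>(1) N_mono[of Q Q'] N_mono[of Q' Q] unfolding chain_subset_def by auto
  qed
  moreover have "prefilter_on ?X (N ` \<eta>)"
    unfolding prefilter_on_def
  proof (intro conjI ballI)
    fix P1 P2 assume P: "P1 \<in> N ` \<eta>" "P2 \<in> N ` \<eta>"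
    then have "P1 \<subseteq> P2 \<or> P2 \<subseteq> P1" using chain unfolding chain_subset_def by metis
    then have "P1 \<inter> P2 = P1 \<or> P1 \<inter> P2 = P2" by auto
    then show "\<exists>P\<in>N ` \<eta>. P \<subseteq> P1 \<inter> P2" using P by auto
  qed (use N_mem N_open openin_subset in blast)+
  ultimately have "nest_on ?X (N ` \<eta>)" unfolding nest_on_def using N_open by blast
  moreover have "local_base_at ?X x (N ` \<eta>)"
    unfolding local_base_at_def
  proof (intro conjI ballI allI impI)
    fix U' assume U': "openin ?X U' \<and> x \<in> U'"
    define U where "U = {y \<in> topspace T. a \<oplus> y \<in> {y \<in> gcarrier G. coset y \<in> U'}}"
    have "openin T U"
      unfolding U_def
      using openin_continuous_map_preimage[OF continuous_add_left[OF a(1)]] U' openin_coset_space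
      by blast
    moreover have "\<zero> \<in> U" using a U' by (simp add: U_def topspace_eq zero_closed add_zero)
    ultimately obtain V where V: "nbhd_of T \<zero> V"
      "\<And>w u. \<lbrakk>w \<in> gcarrier G; u \<in> gcarrier G;
          coset w \<in> ?X closure_of (coset ` V); coset u \<in> ?X closure_of (coset ` V)\<rbrakk>
        \<Longrightarrow> coset (\<ominus> w \<oplus> u) \<in> coset ` U"
      using nbhd_coset_difference[OF nbhd_of_zeroI] by metis
    obtain V0 where V0: "openin T V0" "\<zero> \<in> V0" "V0 \<subseteq> V" using V(1) unfolding nbhd_of_def by blast
    have "openin ?X (coset ` V0)" "coset \<zero> \<in> coset ` V0" using V0 openin_coset_image by auto
    then obtain Q where Q: "Q \<in> \<eta>" "Q \<subseteq> coset ` V0"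
      using \<eta>(2) unfolding family_converges_def by meson
    have "Q \<subseteq> coset ` V" using Q(2) image_mono[OF V0(3), of coset] by (rule subset_trans)
    then have sub: "?X interior_of (?X closure_of Q) \<subseteq> ?X closure_of (coset ` V)"
      using subset_trans[OF interior_of_subset closure_of_mono] by metis
    have "N Q \<subseteq> U'"
    proof
      fix y assume "y \<in> N Q"
      then obtain w u where wu: "w \<in> gcarrier G" "u \<in> gcarrier G" "y = coset (a \<oplus> (\<ominus> w \<oplus> u))"
        "coset w \<in> ?X interior_of (?X closure_of Q)" "coset u \<in> ?X interior_of (?X closure_of Q)"
        unfolding N_def difference_nbhd_def by auto
      then have "coset (\<ominus> w \<oplus> u) \<in> coset ` U" using V(2) subsetD[OF sub] by simp
      then obtain t where t: "t \<in> U" "coset (\<ominus> w \<oplus> u) = coset t" by auto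
      then have "t \<in> gcarrier G" by (simp add: U_def topspace_eq)
      then have "y = coset (a \<oplus> t)"
        using wu(3) t(2) coset_add_left_cong[OF a(1) add_closed[OF minus_closed[OF wu(1)] wu(2)]]
        by simp
      then show "y \<in> U'" using t(1) by (simp add: U_def)
    qed
    then show "\<exists>B\<in>N ` \<eta>. B \<subseteq> U'" using Q by blast
  qed (use N_mem N_open in auto)
  ultimately show "nested_at ?X x" unfolding nested_at_def by blast
qed

end

theorem theorem3p4:
  fixes G :: "('a, 'b) gyro_scheme" and T :: "'a topology" and H :: "'a set"
  assumes "strongly_topological_gyrogroup G T"
    and "strong_subgyrogroup G H"
    and "closedin T H"
    and "neutral_subgyrogroup G T H"
  shows "biradial_space (coset_space G T H) \<longleftrightarrow> nested_space (coset_space G T H)"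
proof -
  interpret strongly_topological_gyrogroup G T by (rule assms(1))
  interpret neutral_strong_subgyrogroup G T H by unfold_locales (rule assms)+
  show ?thesis using biradial_coset_space_imp_nested nested_imp_biradial by blast
qed

end
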